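(* $\mathsf{non}(\mathsf{S}_{fin}(\mathcal{B}_\mathrm{T},\mathcal{B}_\Omega))=\mathsf{non}(\mathsf{S}_{fin}(\mathrm{T},\Omega))=\mathfrak{d}$.
   Context: All spaces $X$ are infinite sets of reals; all covers considered are assumed not to contain $X$ as a member. A cover is an $\omega$-cover of $X$ if every finite subset of $X$ lies in some member; large if each point lies in infinitely many members. A large cover $\mathcal{U}$ is a $\tau$-cover if for all $x,y\in X$, either ($x\in U\Rightarrow y\in U$) for all but finitely many $U\in\mathcal{U}$, or ($y\in U\Rightarrow x\in U$) for all but finitely many $U\in\mathcal{U}$. $\Omega,\mathrm{T}$ are the collections of countable open $\omega$-, $\tau$-covers; $\mathcal{B}_\Omega,\mathcal{B}_\mathrm{T}$ their countable Borel analogues. $X$ satisfies $\mathsf{S}_{fin}(\mathfrak{U},\mathfrak{V})$ if for every sequence $(\mathcal{U}_n)$ of members of $\mathfrak{U}$ there are finite (possibly empty) $\mathcal{F}_n\subseteq\mathcal{U}_n$ with $\bigcup_n\mathcal{F}_n\in\mathfrak{V}$. For a class $\mathcal{J}$ of sets of reals, $\mathsf{non}(\mathcal{J})$ is the minimal cardinality of a set of reals not in $\mathcal{J}$. $\mathfrak{d}$ is the minimal size of a dominating subset of $\mathbb{N}^\mathbb{N}$ with respect to eventual domination. *)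

theory Defs
  imports "HOL-Analysis.Analysis"
begin

unbundle cardinal_syntax

text \<open>
  A space is a set of reals with the subspace topology, so the members of a cover of \<open>X\<close> are
  subsets of \<open>X\<close>. The whole space is never a member of a cover.
\<close>

definition is_cover :: "real set \<Rightarrow> real set set \<Rightarrow> bool" where
  "is_cover X \<U> \<longleftrightarrow> (\<forall>U\<in>\<U>. U \<subseteq> X) \<and> X \<notin> \<U> \<and> \<Union>\<U> = X"

definition omega_cover :: "real set \<Rightarrow> real set set \<Rightarrow> bool" where
  "omega_cover X \<U> \<longleftrightarrow> is_cover X \<U> \<and> (\<forall>F. finite F \<and> F \<subseteq> X \<longrightarrow> (\<exists>U\<in>\<U>. F \<subseteq> U))"

definition large_cover :: "real set \<Rightarrow> real set set \<Rightarrow> bool" where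
  "large_cover X \<U> \<longleftrightarrow> is_cover X \<U> \<and> (\<forall>x\<in>X. infinite {U\<in>\<U>. x \<in> U})"

definition tau_cover :: "real set \<Rightarrow> real set set \<Rightarrow> bool" where
  "tau_cover X \<U> \<longleftrightarrow> large_cover X \<U> \<and>
     (\<forall>x\<in>X. \<forall>y\<in>X. finite {U\<in>\<U>. \<not> (x \<in> U \<longrightarrow> y \<in> U)} \<or>
                   finite {U\<in>\<U>. \<not> (y \<in> U \<longrightarrow> x \<in> U)})"

definition open_family :: "real set \<Rightarrow> real set set \<Rightarrow> bool" where
  "open_family X \<U> \<longleftrightarrow> countable \<U> \<and> (\<forall>U\<in>\<U>. openin (top_of_set X) U)"

definition borel_family :: "real set \<Rightarrow> real set set \<Rightarrow> bool" where
  "borel_family X \<U> \<longleftrightarrow> countable \<U> \<and> \<U> \<subseteq> sets (restrict_space borel X)"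

definition open_Omega :: "real set \<Rightarrow> real set set set" where
  "open_Omega X = {\<U>. open_family X \<U> \<and> omega_cover X \<U>}"

definition open_Tau :: "real set \<Rightarrow> real set set set" where
  "open_Tau X = {\<U>. open_family X \<U> \<and> tau_cover X \<U>}"

definition borel_Omega :: "real set \<Rightarrow> real set set set" where
  "borel_Omega X = {\<U>. borel_family X \<U> \<and> omega_cover X \<U>}"

definition borel_Tau :: "real set \<Rightarrow> real set set set" where
  "borel_Tau X = {\<U>. borel_family X \<U> \<and> tau_cover X \<U>}"

definition S_fin ::
  "(real set \<Rightarrow> real set set set) \<Rightarrow> (real set \<Rightarrow> real set set set) \<Rightarrow> real set set" where
  "S_fin \<AA> \<BB> = {X. \<forall>\<U> :: nat \<Rightarrow> real set set. (\<forall>n. \<U> n \<in> \<AA> X) \<longrightarrow>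
     (\<exists>\<F>. (\<forall>n. finite (\<F> n) \<and> \<F> n \<subseteq> \<U> n) \<and> (\<Union>n. \<F> n) \<in> \<BB> X)}"

text \<open>
  The least cardinality of a member of \<open>P\<close>, as a cardinal order; cardinals are compared up to
  order isomorphism \<open>=o\<close>. The value is unspecified if \<open>P\<close> is empty.
\<close>

definition min_card :: "'a set set \<Rightarrow> 'a rel" where
  "min_card P = |SOME A. A \<in> P \<and> (\<forall>B\<in>P. |A| \<le>o |B| )|"

lemma min_card_exists:
  assumes "P \<noteq> {}"
  shows "\<exists>A\<in>P. min_card P = |A| \<and> (\<forall>B\<in>P. |A| \<le>o |B| )"
proof -
  have "card_of ` P \<noteq> {}" using assms by simp
  then obtain r where r: "r \<in> card_of ` P"
    and min: "\<And>s. (s, r) \<in> ordLess \<Longrightarrow> s \<notin> card_of ` P"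
    using wf_ordLess by (metis wfE_min ex_in_conv)
  then obtain A where A: "A \<in> P" "r = |A|" by blast
  have "|A| \<le>o |B|" if "B \<in> P" for B
    using min[of "|B|"] that A(2)
    by (metis card_of_Well_order image_eqI not_ordLess_iff_ordLeq)
  with A(1) have "\<exists>A. A \<in> P \<and> (\<forall>B\<in>P. |A| \<le>o |B| )" by blast
  from someI_ex[OF this] show ?thesis unfolding min_card_def by blast
qed

text \<open>
  Spaces are infinite by convention, so only infinite sets of reals compete in \<open>non\<close>.
\<close>

definition non :: "real set set \<Rightarrow> real rel" where
  "non J = min_card {X. infinite X \<and> X \<notin> J}"

definition dominating :: "(nat \<Rightarrow> nat) set \<Rightarrow> bool" where
  "dominating D \<longleftrightarrow> (\<forall>g. \<exists>f\<in>D. \<forall>\<^sub>F n in sequentially. g n \<le> f n)"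

definition dominating_number :: "(nat \<Rightarrow> nat) rel" where
  "dominating_number = min_card {D. dominating D}"

end

theory Submission
  imports Defs
begin

text \<open>
  A \<open>\<tau>\<close>-cover of an infinite space is an \<open>\<omega>\<close>-cover: modulo finitely many members,
  \<open>x \<in> U \<longrightarrow> y \<in> U\<close> is a total preorder on the points, so a finite set of points has a least
  element, and almost every one of the infinitely many members containing it contains the whole
  finite set. If the covers \<open>\<U> n\<close> are enumerated, sending a finite \<open>F \<subseteq> X\<close> to the function whose value at
  \<open>n\<close> is the first index at which \<open>\<U> n\<close> contains \<open>F\<close> then yields a dominating family of size at most
  \<open>|X|\<close> whenever no finite selections form an \<open>\<omega>\<close>-cover.

  In the other direction, the iterates of \<open>tan\<close> are continuous where they are all defined, and their
  values along an orbit can be made to exceed any given \<open>g\<close>, since every branch of \<open>tan\<close>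
  is onto. One such point for every member of a dominating family gives a space on which
  the sublevel sets of the \<open>n\<close>-th iterate form increasing open covers witnessing the failure of
  \<open>S_fin\<close>.
\<close>

section \<open>Finite subsets of a space, and tau-covers as omega-covers\<close>

lemma card_of_finite_subsets:
  assumes "infinite X"
  shows "|{F. finite F \<and> F \<subseteq> X}| \<le>o |X|"
proof -
  define S where "S n = {F. finite F \<and> F \<subseteq> X \<and> card F = n}" for n
  have S: "|S n| \<le>o |X|" for n
  proof (induction n)
    case 0
    have "S 0 \<subseteq> {{}}" by (auto simp: S_def)
    then have "finite (S 0)" by (rule finite_subset) simp
    then show ?case using assms
      by (simp add: card_of_Well_order card_of_ordLeq_finite ordLeq3_finite_infinite)
  next
    case (Suc n)
    \<comment> \<open>Removing one element exhibits each set of size \<open>Suc n\<close> as an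
      image of a pair, so induction only needs that \<open>X\<close> absorbs its own square.\<close>
    have "S (Suc n) \<subseteq> (\<lambda>(x, F). insert x F) ` (X \<times> S n)"
    proof
      fix F assume F: "F \<in> S (Suc n)"
      then obtain x where x: "x \<in> F" unfolding S_def by fastforce
      have "F = insert x (F - {x})" "x \<in> X" "F - {x} \<in> S n"
        using F x by (auto simp: S_def)
      then show "F \<in> (\<lambda>(x, F). insert x F) ` (X \<times> S n)"
        by (metis (mono_tags, lifting) SigmaI case_prod_conv image_eqI)
    qed
    then have "|S (Suc n)| \<le>o |X \<times> S n|"
      by (rule surj_imp_ordLeq)
    also have "|X \<times> S n| \<le>o |X|"
      using card_of_Sigma_ordLeq_infinite[of X X "\<lambda>_. S n"] Suc assms
      by (simp add: card_of_mono1)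
    finally show ?case .
  qed
  have "|UNIV :: nat set| \<le>o |X|"
    using assms infinite_iff_card_of_nat by blast
  then have "|\<Union>n. S n| \<le>o |X|"
    using card_of_UNION_ordLeq_infinite[OF assms] S by blast
  moreover have "{F. finite F \<and> F \<subseteq> X} = (\<Union>n. S n)"
    by (auto simp: S_def)
  ultimately show ?thesis by simp
qed

lemma tau_cover_imp_omega_cover:
  assumes "infinite X" and tau: "tau_cover X \<U>"
  shows "omega_cover X \<U>"
proof -
  define le where "le x y \<longleftrightarrow> finite {U\<in>\<U>. \<not> (x \<in> U \<longrightarrow> y \<in> U)}" for x y
  have total: "le x y \<or> le y x" if "x \<in> X" "y \<in> X" for x y
    using tau that unfolding tau_cover_def le_def by blast
  have trans: "le x z" if "le x y" "le y z" for x y z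
  proof -
    have "{U\<in>\<U>. \<not> (x \<in> U \<longrightarrow> z \<in> U)} \<subseteq>
      {U\<in>\<U>. \<not> (x \<in> U \<longrightarrow> y \<in> U)} \<union> {U\<in>\<U>. \<not> (y \<in> U \<longrightarrow> z \<in> U)}" by blast
    then show ?thesis using that unfolding le_def by (meson finite_UnI finite_subset)
  qed
  have cover: "is_cover X \<U>" and large: "\<And>x. x \<in> X \<Longrightarrow> infinite {U\<in>\<U>. x \<in> U}"
    using tau unfolding tau_cover_def large_cover_def by auto
  have least: "\<exists>x\<in>F. \<forall>y\<in>F. le x y" if "finite F" "F \<noteq> {}" "F \<subseteq> X" for F
    using that
  proof (induction F rule: finite_ne_induct)
    case (singleton x)
    then show ?case using total by auto
  next
    case (insert z F)
    then obtain x where x: "x \<in> F" "\<forall>y\<in>F. le x y" by auto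
    show ?case
    proof (cases "le x z")
      case True
      with x show ?thesis by auto
    next
      case False
      then have "le z x" "le z z" using total x(1) insert.prems by auto
      then show ?thesis using x trans by blast
    qed
  qed
  have "\<exists>U\<in>\<U>. F \<subseteq> U" if F: "finite F" "F \<subseteq> X" for F
  proof (cases "F = {}")
    case True
    have "\<Union>\<U> \<noteq> {}" using assms(1) cover unfolding is_cover_def by auto
    then show ?thesis using True by auto
  next
    case False
    then obtain x where x: "x \<in> F" "\<forall>y\<in>F. le x y" using least F by blast
    \<comment> \<open>Only finitely many members contain the least point \<open>x\<close> but miss a
      point of \<open>F\<close>; infinitely many contain \<open>x\<close>, so some member contains
      all of \<open>F\<close>.\<close>
    have "finite (\<Union>y\<in>F. {U\<in>\<U>. \<not> (x \<in> U \<longrightarrow> y \<in> U)})"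
      using x(2) F(1) unfolding le_def by blast
    moreover have "infinite {U\<in>\<U>. x \<in> U}" using large x(1) F(2) by blast
    ultimately obtain U where "U \<in> {U\<in>\<U>. x \<in> U}"
      "U \<notin> (\<Union>y\<in>F. {U\<in>\<U>. \<not> (x \<in> U \<longrightarrow> y \<in> U)})"
      by (meson finite_subset subsetI)
    then show ?thesis by blast
  qed
  with cover show ?thesis unfolding omega_cover_def by blast
qed

section \<open>Lower bound: a dominating family from a failing sequence of Borel covers\<close>

lemma dominating_number_le_if_not_S_fin_borel:
  assumes inf: "infinite X" and X: "X \<notin> S_fin borel_Tau borel_Omega"
  shows "dominating_number \<le>o |X|"
proof -
  obtain \<U> :: "nat \<Rightarrow> real set set" where \<U>: "\<And>n. \<U> n \<in> borel_Tau X"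
    and fail: "\<And>\<F>. (\<forall>n. finite (\<F> n) \<and> \<F> n \<subseteq> \<U> n) \<Longrightarrow> (\<Union>n. \<F> n) \<notin> borel_Omega X"
    using X unfolding S_fin_def by blast
  have omega: "omega_cover X (\<U> n)" and fam: "borel_family X (\<U> n)" for n
    using \<U>[of n] tau_cover_imp_omega_cover[OF inf] unfolding borel_Tau_def by auto
  have ne: "\<U> n \<noteq> {}" for n
    using omega[of n] unfolding omega_cover_def by blast
  define e where "e n = from_nat_into (\<U> n)" for n
  have e: "e n m \<in> \<U> n" for n m
    unfolding e_def using ne by (rule from_nat_into)
  have ex: "\<exists>m. F \<subseteq> e n m" if "finite F" "F \<subseteq> X" for F n
  proof -
    obtain U where "U \<in> \<U> n" "F \<subseteq> U"
      using omega[of n] \<open>finite F\<close> \<open>F \<subseteq> X\<close> unfolding omega_cover_def by blast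
    then show ?thesis
      using fam[of n] from_nat_into_surj unfolding e_def borel_family_def by metis
  qed
  define f where "f F n = (LEAST m. F \<subseteq> e n m)" for F n
  define D where "D = f ` {F. finite F \<and> F \<subseteq> X}"
  have "\<exists>h\<in>D. \<forall>\<^sub>F n in sequentially. g n \<le> h n" for g
  proof -
    \<comment> \<open>Selecting an initial segment of each cover turns failure of the selection for
      \<open>g\<close> into a finite set whose first indices all exceed \<open>g\<close>.\<close>
    define \<F> where "\<F> n = e n ` {..g n}" for n
    have sub: "\<forall>n. finite (\<F> n) \<and> \<F> n \<subseteq> \<U> n"
      unfolding \<F>_def using e by auto
    have "countable (\<Union>n. \<F> n)" using sub by (simp add: countable_finite)
    then have bf: "borel_family X (\<Union>n. \<F> n)"
      using sub fam unfolding borel_family_def by blast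
    with fail[OF sub] have no: "\<not> omega_cover X (\<Union>n. \<F> n)"
      unfolding borel_Omega_def by blast
    define \<G> where "\<G> = (\<Union>n. \<F> n)"
    have mem: "U \<subseteq> X \<and> U \<noteq> X" if "U \<in> \<G>" for U
    proof -
      obtain n where "U \<in> \<U> n" using \<open>U \<in> \<G>\<close> sub unfolding \<G>_def by blast
      then show ?thesis using omega[of n] unfolding omega_cover_def is_cover_def by blast
    qed
    have "\<exists>F. finite F \<and> F \<subseteq> X \<and> (\<forall>U\<in>\<G>. \<not> F \<subseteq> U)"
    proof (rule ccontr)
      assume "\<not> ?thesis"
      then have *: "\<exists>U\<in>\<G>. F \<subseteq> U" if "finite F" "F \<subseteq> X" for F using that by metis
      have "x \<in> \<Union>\<G>" if "x \<in> X" for x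
        using *[of "{x}"] that by auto
      then have "\<Union>\<G> = X" using mem by blast
      then have "is_cover X \<G>" using mem unfolding is_cover_def by metis
      then have "omega_cover X \<G>" using * unfolding omega_cover_def by metis
      with no show False unfolding \<G>_def by contradiction
    qed
    then obtain F where F: "finite F" "F \<subseteq> X" "\<And>U. U \<in> \<G> \<Longrightarrow> \<not> F \<subseteq> U"
      by metis
    have "g n \<le> f F n" for n
    proof (rule ccontr)
      assume "\<not> g n \<le> f F n"
      then have "e n (f F n) \<in> \<G>"
        unfolding \<G>_def \<F>_def by (intro UN_I[of n] imageI) auto
      moreover have "F \<subseteq> e n (f F n)"
        unfolding f_def by (rule LeastI_ex[OF ex[OF F(1,2)]])
      ultimately show False using F(3) by blast
    qed
    then have "\<forall>\<^sub>F n in sequentially. g n \<le> f F n" by simp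
    moreover have "f F \<in> D" using F(1,2) unfolding D_def by simp
    ultimately show ?thesis by (rule bexI)
  qed
  then have D: "D \<in> {D. dominating D}"
    unfolding dominating_def by simp
  then have "dominating_number \<le>o |D|"
    using min_card_exists[of "{D. dominating D}"] unfolding dominating_number_def by fastforce
  also have "|D| \<le>o |{F. finite F \<and> F \<subseteq> X}|"
    unfolding D_def by (rule card_of_image)
  also have "|{F. finite F \<and> F \<subseteq> X}| \<le>o |X|"
    by (rule card_of_finite_subsets[OF inf])
  finally show ?thesis .
qed

text \<open>Open covers are Borel, and whatever is selected from open covers consists of open sets
  again.\<close>

lemma S_fin_borel_subset_S_fin_open: "S_fin borel_Tau borel_Omega \<subseteq> S_fin open_Tau open_Omega"
proof
  fix X assume X: "X \<in> S_fin borel_Tau borel_Omega"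
  have borel: "borel_family X \<U>" if "open_family X \<U>" for \<U>
    using that unfolding open_family_def borel_family_def openin_open sets_restrict_space
    by (auto intro!: imageI)
  show "X \<in> S_fin open_Tau open_Omega"
    unfolding S_fin_def
  proof (intro CollectI allI impI)
    fix \<U> :: "nat \<Rightarrow> real set set" assume \<U>: "\<forall>n. \<U> n \<in> open_Tau X"
    then have "\<forall>n. \<U> n \<in> borel_Tau X"
      using borel unfolding open_Tau_def borel_Tau_def by blast
    then obtain \<F> where \<F>: "\<forall>n. finite (\<F> n) \<and> \<F> n \<subseteq> \<U> n" "(\<Union>n. \<F> n) \<in> borel_Omega X"
      using X unfolding S_fin_def by blast
    then have "open_family X (\<Union>n. \<F> n)"
      using \<U> unfolding open_family_def open_Tau_def borel_Omega_def borel_family_def by fast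
    with \<F> show "\<exists>\<F>. (\<forall>n. finite (\<F> n) \<and> \<F> n \<subseteq> \<U> n) \<and> (\<Union>n. \<F> n) \<in> open_Omega X"
      unfolding open_Omega_def borel_Omega_def by blast
  qed
qed

section \<open>Tangent orbits above a given function\<close>

lemma tan_orbit_ge:
  fixes g :: "nat \<Rightarrow> nat"
  shows "\<exists>x::real. \<forall>n. cos ((tan ^^ n) x) \<noteq> 0 \<and> real (g n) \<le> (tan ^^ n) x"
proof -
  \<comment> \<open>The inverse branch of \<open>tan\<close> around \<open>(g n + 1) * pi\<close>;
    the extra period keeps its values above \<open>g n\<close> even when
    \<open>g n = 0\<close>.\<close>
  define s where "s n y = arctan y + real (Suc (g n)) * pi" for n y
  \<comment> \<open>\<open>h n\<close> composes the branches with \<open>s 0\<close> outermost, so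
    it is a right inverse of the \<open>n\<close>-th iterate of \<open>tan\<close>.\<close>
  define h where "h = rec_nat (\<lambda>y. y) (\<lambda>n r y. r (s n y))"
  have h0: "h 0 y = y" and hS: "h (Suc n) y = h n (s n y)" for n y
    unfolding h_def by simp_all
  define I where "I n = {real (Suc (g n)) * pi - pi/2 .. real (Suc (g n)) * pi + pi/2}" for n
  have s_I: "s n y \<in> I n" for n y
    using arctan_bounded[of y] unfolding s_def I_def by auto
  have cont_s: "continuous_on A (s n)" for A n
    unfolding s_def by (intro continuous_intros)
  have cont_h: "continuous_on A (h n)" for A n
  proof (induction n arbitrary: A)
    case 0
    then show ?case by (simp add: h0[abs_def])
  next
    case (Suc n)
    show ?case
      unfolding hS[abs_def] by (rule continuous_on_compose2[OF Suc cont_s subset_UNIV])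
  qed
  have tan_s: "tan (s n y) = y" for n y
    unfolding s_def by (simp only: tan_periodic_nat tan_arctan)
  have tan_h: "(tan ^^ n) (h n y) = y" for n y
    by (induction n arbitrary: y) (simp_all add: h0 hS tan_s)
  \<comment> \<open>Closed intervals make these nested sets compact; their endpoints, poles of
    \<open>tan\<close>, are harmless since every \<open>h n\<close> is continuous on the whole
    line.\<close>
  define P where "P n = h n ` I n" for n
  have "P (Suc n) \<subseteq> P n" for n
    unfolding P_def using s_I by (auto simp: hS)
  then have dec: "P n \<subseteq> P m" if "m \<le> n" for m n
    using lift_Suc_antimono_le[of P] that by blast
  have "\<Inter> (range P) \<noteq> {}"
  proof (rule compact_nest[OF _ _ dec])
    show "compact (P n)" for n
      unfolding P_def I_def by (intro compact_continuous_image cont_h compact_Icc)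
    show "P n \<noteq> {}" for n
      using s_I unfolding P_def by blast
  qed
  then obtain x where x: "\<And>n. x \<in> P n" by blast
  have "cos ((tan ^^ n) x) \<noteq> 0 \<and> real (g n) \<le> (tan ^^ n) x" for n
  proof -
    \<comment> \<open>Membership at level \<open>Suc n\<close> rather than \<open>n\<close> makes
      the \<open>n\<close>-th iterate a value of \<open>s n\<close>, hence strictly between two
      poles.\<close>
    obtain y where "x = h (Suc n) y" using x[of "Suc n"] unfolding P_def by blast
    then have y: "(tan ^^ n) x = s n y" by (simp add: hS tan_h)
    have "cos (s n y) = cos (arctan y) * (- 1) ^ Suc (g n)"
      unfolding s_def cos_add sin_npi cos_npi by simp
    moreover have "real (g n) \<le> s n y"
    proof -
      have "real (g n) * 1 \<le> real (g n) * pi"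
        using pi_gt3 by (intro mult_left_mono) auto
      moreover have "real (Suc (g n)) * pi = real (g n) * pi + pi" by (simp add: algebra_simps)
      ultimately show ?thesis
        using arctan_bounded[of y] pi_gt3 unfolding s_def by linarith
    qed
    ultimately show ?thesis by (simp add: y)
  qed
  then show ?thesis by blast
qed

lemma continuous_on_tan_funpow:
  fixes A :: "real set"
  assumes "\<And>x n. x \<in> A \<Longrightarrow> cos ((tan ^^ n) x) \<noteq> 0"
  shows "continuous_on A (tan ^^ n)"
proof (induction n)
  case 0
  then show ?case by simp
next
  case (Suc n)
  have "continuous_on A (\<lambda>x. tan ((tan ^^ n) x))"
    using Suc by (rule Transcendental.continuous_on_tan) (simp add: assms)
  then show ?case by (simp add: o_def)
qed

section \<open>Increasing covers and the upper bound\<close>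

lemma infinite_range_increasing_cover:
  fixes V :: "nat \<Rightarrow> 'a set"
  assumes "mono V" "\<And>m. V m \<noteq> (\<Union>m. V m)"
  shows "infinite (range V)"
proof
  assume "finite (range V)"
  then obtain C where C: "finite C" "range V = V ` C"
    by (meson finite_subset_image order_refl)
  have "V m \<subseteq> V (Max C)" for m
  proof -
    obtain c where "c \<in> C" "V m = V c" using C(2) by blast
    then show ?thesis using C(1) monoD[OF assms(1)] by simp
  qed
  then have "V (Max C) = (\<Union>m. V m)" by blast
  with assms(2) show False by blast
qed

text \<open>Each point is missed by only finitely many members, so both implications in the tau
  condition hold almost everywhere. Largeness also needs infinitely many distinct members, as a
  cover is a set and repetitions collapse.\<close>

lemma tau_cover_increasing:
  fixes V :: "nat \<Rightarrow> real set"
  assumes "mono V" "\<And>m. V m \<noteq> X" "(\<Union>m. V m) = X"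
  shows "tau_cover X (range V)"
proof -
  have cofin: "finite {U \<in> range V. x \<notin> U}" if "x \<in> X" for x
  proof -
    obtain m where m: "x \<in> V m" using assms(3) \<open>x \<in> X\<close> by blast
    have "{U \<in> range V. x \<notin> U} \<subseteq> V ` {..<m}"
    proof
      fix U assume "U \<in> {U \<in> range V. x \<notin> U}"
      then obtain k where k: "U = V k" "x \<notin> V k" by blast
      then have "k < m" using m monoD[OF assms(1), of m k] by (cases "m \<le> k") auto
      with k show "U \<in> V ` {..<m}" by blast
    qed
    then show ?thesis by (rule finite_subset) simp
  qed
  have inf: "infinite (range V)"
    using infinite_range_increasing_cover[OF assms(1)] assms(2,3) by metis
  have "infinite {U \<in> range V. x \<in> U}" if "x \<in> X" for x
  proof
    assume "finite {U \<in> range V. x \<in> U}"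
    then have "finite ({U \<in> range V. x \<in> U} \<union> {U \<in> range V. x \<notin> U})"
      using cofin[OF that] by simp
    moreover have "{U \<in> range V. x \<in> U} \<union> {U \<in> range V. x \<notin> U} = range V" by blast
    ultimately show False using inf by simp
  qed
  moreover have "is_cover X (range V)"
    using assms(2,3) unfolding is_cover_def by blast
  moreover have "finite {U \<in> range V. \<not> (x \<in> U \<longrightarrow> y \<in> U)}" if "y \<in> X" for x y
    using cofin[OF that] by (rule rev_finite_subset) blast
  ultimately show ?thesis
    unfolding tau_cover_def large_cover_def by blast
qed

lemma not_S_fin_open_le_dominating:
  fixes D :: "(nat \<Rightarrow> nat) set"
  assumes "\<And>g. \<exists>f\<in>D. \<forall>n. g n \<le> f n"
  shows "\<exists>X. infinite X \<and> X \<notin> S_fin open_Tau open_Omega \<and> |X| \<le>o |D|"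
proof -
  obtain p :: "(nat \<Rightarrow> nat) \<Rightarrow> real" where
    p: "\<And>g n. cos ((tan ^^ n) (p g)) \<noteq> 0 \<and> real (g n) \<le> (tan ^^ n) (p g)"
    using tan_orbit_ge by metis
  define X where "X = p ` D"
  define V where "V n m = {x \<in> X. (tan ^^ n) x < real m}" for n m
  have mono: "mono (V n)" for n
    unfolding V_def mono_def by fastforce
  have union: "(\<Union>m. V n m) = X" for n
    using reals_Archimedean2 unfolding V_def by fast
  \<comment> \<open>Everywhere domination is what lets one point escape at every \<open>n\<close>.
    Constant \<open>g\<close> gives properness of the covers; general \<open>g\<close> defeats the
    selections.\<close>
  have avoid: "\<exists>x\<in>X. \<forall>n. x \<notin> V n (g n)" for g
  proof -
    obtain f where f: "f \<in> D" "\<And>n. g n \<le> f n" using assms by blast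
    have "real (g n) \<le> (tan ^^ n) (p f)" for n
      using f(2)[of n] p[of n f] by linarith
    then have "\<forall>n. p f \<notin> V n (g n)" unfolding V_def by (simp add: not_less)
    with f(1) show ?thesis unfolding X_def by blast
  qed
  have proper: "V n m \<noteq> X" for n m
    using avoid[of "\<lambda>_. m"] by blast
  have "infinite (range (V 0))"
    using infinite_range_increasing_cover[OF mono] proper union by metis
  moreover have "range (V 0) \<subseteq> Pow X" unfolding V_def by blast
  \<comment> \<open>A finite space has too few subsets for an infinite cover.\<close>
  ultimately have inf: "infinite X" by (meson finite_Pow_iff finite_subset)
  have "continuous_on X (tan ^^ n)" for n
    by (rule continuous_on_tan_funpow) (auto simp: X_def p)
  then have "openin (top_of_set X) (X \<inter> (tan ^^ n) -` {..<real m})" for n m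
    by (simp add: continuous_openin_preimage_gen)
  moreover have "X \<inter> (tan ^^ n) -` {..<real m} = V n m" for n m
    unfolding V_def by auto
  ultimately have "open_family X (range (V n))" for n
    unfolding open_family_def by auto
  then have Tau: "range (V n) \<in> open_Tau X" for n
    unfolding open_Tau_def using tau_cover_increasing[OF mono proper union] by blast
  have "X \<notin> S_fin open_Tau open_Omega"
  proof
    assume "X \<in> S_fin open_Tau open_Omega"
    then have "\<exists>\<F>. (\<forall>n. finite (\<F> n) \<and> \<F> n \<subseteq> range (V n)) \<and> (\<Union>n. \<F> n) \<in> open_Omega X"
      using Tau unfolding S_fin_def by (auto dest!: spec[where x="\<lambda>n. range (V n)"])
    then obtain \<F> where \<F>: "\<And>n. finite (\<F> n) \<and> \<F> n \<subseteq> range (V n)"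
      and "(\<Union>n. \<F> n) \<in> open_Omega X" by metis
    then have cover: "\<Union>(\<Union>n. \<F> n) = X"
      unfolding open_Omega_def omega_cover_def is_cover_def by blast
    have "\<exists>g. \<forall>U\<in>\<F> n. U \<subseteq> V n g" for n
    proof -
      obtain C where C: "finite C" "\<F> n = V n ` C"
        using \<F> by (meson finite_subset_image)
      \<comment> \<open>If nothing is selected at \<open>n\<close>, \<open>Max C\<close> is
        unspecified but the claim is vacuous.\<close>
      have "\<forall>U\<in>\<F> n. U \<subseteq> V n (Max C)"
        using C monoD[OF mono] by simp
      then show ?thesis by blast
    qed
    then obtain g where "\<And>n U. U \<in> \<F> n \<Longrightarrow> U \<subseteq> V n (g n)" by metis
    then show False using avoid[of g] cover by blast
  qed
  moreover have "|X| \<le>o |D|" unfolding X_def by (rule card_of_image)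
  ultimately show ?thesis using inf by blast
qed

section \<open>From eventual to everywhere domination\<close>

lemma infinite_if_dominating:
  assumes "dominating D"
  shows "infinite D"
proof
  assume fin: "finite D"
  define g where "g n = Suc (Max ((\<lambda>f. f n) ` D))" for n
  obtain f where f: "f \<in> D" "\<forall>\<^sub>F n in sequentially. g n \<le> f n"
    using assms unfolding dominating_def by blast
  have "f n < g n" for n
    unfolding g_def using fin f(1) by (simp add: less_Suc_eq_le)
  with f(2) show False
    by (simp add: not_le[symmetric])
qed

text \<open>Adding a constant absorbs the finitely many exceptions, and countably many constants do
  not enlarge an infinite family.\<close>

lemma everywhere_dominating_ordLeq:
  assumes "dominating D"
  shows "\<exists>E :: (nat \<Rightarrow> nat) set. (\<forall>g. \<exists>f\<in>E. \<forall>n. g n \<le> f n) \<and> |E| \<le>o |D|"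
proof -
  define E where "E = (\<lambda>(f, k) n. f n + k) ` (D \<times> (UNIV :: nat set))"
  have "\<exists>f\<in>E. \<forall>n. g n \<le> f n" for g :: "nat \<Rightarrow> nat"
  proof -
    obtain f N where f: "f \<in> D" "\<And>n. n \<ge> N \<Longrightarrow> g n \<le> f n"
      using assms unfolding dominating_def eventually_sequentially by blast
    have "g n \<le> f n + Max (g ` {..N})" for n
    proof (cases "n \<le> N")
      case True
      then have "g n \<le> Max (g ` {..N})" by simp
      then show ?thesis by simp
    next
      case False
      then show ?thesis using f(2)[of n] by simp
    qed
    moreover have "(\<lambda>n. f n + Max (g ` {..N})) \<in> E"
      unfolding E_def using f(1) by (intro image_eqI[of _ _ "(f, Max (g ` {..N}))"]) auto
    ultimately show ?thesis by (intro bexI) auto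
  qed
  moreover have "|E| \<le>o |D|"
  proof -
    have inf: "infinite D" using infinite_if_dominating[OF assms] .
    have "|E| \<le>o |D \<times> (UNIV :: nat set)|"
      unfolding E_def by (rule card_of_image)
    also have "|D \<times> (UNIV :: nat set)| =o |D|"
      using inf infinite_iff_card_of_nat
      by (intro card_of_Times_infinite_simps(1)) auto
    finally show ?thesis .
  qed
  ultimately show ?thesis by blast
qed

theorem theorem4p1:
  "non (S_fin borel_Tau borel_Omega) =o non (S_fin open_Tau open_Omega) \<and>
   non (S_fin open_Tau open_Omega) =o dominating_number"
proof -
  let ?B = "{X. infinite X \<and> X \<notin> S_fin borel_Tau borel_Omega}"
  let ?O = "{X. infinite X \<and> X \<notin> S_fin open_Tau open_Omega}"
  have "dominating UNIV"
    unfolding dominating_def by (meson UNIV_I always_eventually order_refl)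
  then obtain D where D: "dominating D" "dominating_number = |D|"
    using min_card_exists[of "{D. dominating D}"] unfolding dominating_number_def by blast
  obtain E :: "(nat \<Rightarrow> nat) set" where E: "\<And>g. \<exists>f\<in>E. \<forall>n. g n \<le> f n" "|E| \<le>o |D|"
    using everywhere_dominating_ordLeq[OF D(1)] by blast
  \<comment> \<open>This space bounds the open value and also shows that both classes of
    counterexamples are nonempty, so both minima are attained.\<close>
  obtain X where X: "X \<in> ?O" "|X| \<le>o |E|"
    using not_S_fin_open_le_dominating[OF E(1)] by blast
  have sub: "?O \<subseteq> ?B" using S_fin_borel_subset_S_fin_open by blast
  obtain Y where Y: "Y \<in> ?O" "non (S_fin open_Tau open_Omega) = |Y|" "\<forall>Z\<in>?O. |Y| \<le>o |Z|"
    using min_card_exists[of ?O] X(1) unfolding non_def by blast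
  obtain Z where Z: "Z \<in> ?B" "non (S_fin borel_Tau borel_Omega) = |Z|" "\<forall>Y\<in>?B. |Z| \<le>o |Y|"
    using min_card_exists[of ?B] X(1) sub unfolding non_def by blast
  \<comment> \<open>The three inequalities close a cycle through \<open>Z\<close>, \<open>Y\<close>
    and \<open>D\<close>.\<close>
  have ZY: "|Z| \<le>o |Y|" using Z(3) Y(1) sub by blast
  have YD: "|Y| \<le>o |D|" using bspec[OF Y(3) X(1)] X(2) E(2) ordLeq_transitive by metis
  have DZ: "|D| \<le>o |Z|"
    using dominating_number_le_if_not_S_fin_borel Z(1) D(2) by auto
  have "|Z| =o |Y|" "|Y| =o |D|"
    using ZY YD DZ by (meson ordIso_iff_ordLeq ordLeq_transitive)+
  then show ?thesis using Y(2) Z(2) D(2) by simp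
qed

end
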